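(* Let $\mathbf{P}\subset\mathbb{C}$ be nonempty and compact. Then for every $A \in C_{n,n}(\mathbf{P})$ the following statements hold. (i) The spectrum of the matrix multiplication operator $\mathcal{A}: C_n(\mathbf{P}) \to C_n(\mathbf{P})$, $(\mathcal{A}f)(\theta)=A(\theta)f(\theta)$, is given by $$\sigma (\mathcal{A}) = \bigcup_{\theta \in \mathbf{P}} \sigma (A(\theta)).$$ (ii) If, in addition, $\mathbf{P}$ is perfect, then $$\sigma_{q}(\mathcal{A}) = \sigma_{\operatorname{ess}}(\mathcal{A}) = \sigma (\mathcal{A}) = \bigcup_{\theta \in \mathbf{P}} \sigma (A(\theta)).$$
   Context: $C_n(\mathbf{P})$ and $C_{n,n}(\mathbf{P})$ denote the spaces of continuous functions on $\mathbf{P}$ with values in $\mathbb{C}^n$, respectively $\mathbb{C}^{n\times n}$; $C_n(\mathbf{P})$ carries the supremum norm. The compact set $\mathbf{P}$ is perfect if it has no isolated points. For a bounded operator $\mathcal{A}$ on a Banach space $X$: $\sigma(\mathcal{A})$ is the spectrum; $\mathcal{A}$ is Fredholm if $\dim\operatorname{Ker}(\mathcal{A})<\infty$ and $\operatorname{codim}\operatorname{Im}(\mathcal{A})<\infty$; the essential spectrum is $\sigma_{\operatorname{ess}}(\mathcal{A})=\{\lambda\in\mathbb{C}\mid\lambda-\mathcal{A}\text{ is not Fredholm}\}$; the approximate point spectrum is $\sigma_q(\mathcal{A})=\{\lambda\in\mathbb{C}\mid\exists (v_k)_{k\in\mathbb{N}}\subset X,\ \|v_k\|=1,\ \lim_{k\to\infty}\|(\lambda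 I-\mathcal{A})v_k\|=0\}$. *)

theory Defs
  imports "HOL-Analysis.Analysis" "HOL-Library.Function_Algebras"
begin

section \<open>Complex normed spaces and their operators\<close>

text \<open>
  Since the space of continuous functions on a set depends on that set, its elements do not form
  a type. A complex normed space is therefore a linear subspace \<open>vecs\<close> of an ambient complex vector
  space: the type \<open>'v\<close> with its additive structure and the scalar multiplication \<open>smult\<close>.
  Only the values of the norm and of operators on \<open>vecs\<close> are relevant.
\<close>

record 'v cnormed =
  vecs :: "'v set"
  smult :: "complex \<Rightarrow> 'v \<Rightarrow> 'v"
  nrm :: "'v \<Rightarrow> real"

definition cbanach_space :: "'v::ab_group_add cnormed \<Rightarrow> bool" where
  "cbanach_space X \<longleftrightarrow>
     vector_space (smult X) \<and> module.subspace (smult X) (vecs X) \<and>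
     (\<forall>x\<in>vecs X. 0 \<le> nrm X x \<and> (nrm X x = 0 \<longleftrightarrow> x = 0)) \<and>
     (\<forall>c. \<forall>x\<in>vecs X. nrm X (smult X c x) = cmod c * nrm X x) \<and>
     (\<forall>x\<in>vecs X. \<forall>y\<in>vecs X. nrm X (x + y) \<le> nrm X x + nrm X y) \<and>
     (\<forall>s::nat \<Rightarrow> 'v. range s \<subseteq> vecs X \<and>
        (\<forall>e>0. \<exists>N. \<forall>m\<ge>N. \<forall>k\<ge>N. nrm X (s m - s k) < e) \<longrightarrow>
        (\<exists>l\<in>vecs X. (\<lambda>k. nrm X (s k - l)) \<longlonglongrightarrow> 0))"

definition bounded_operator :: "'v::ab_group_add cnormed \<Rightarrow> ('v \<Rightarrow> 'v) \<Rightarrow> bool" where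
  "bounded_operator X T \<longleftrightarrow>
     T ` vecs X \<subseteq> vecs X \<and>
     (\<forall>x\<in>vecs X. \<forall>y\<in>vecs X. T (x + y) = T x + T y) \<and>
     (\<forall>c. \<forall>x\<in>vecs X. T (smult X c x) = smult X c (T x)) \<and>
     (\<exists>K. \<forall>x\<in>vecs X. nrm X (T x) \<le> K * nrm X x)"

definition shift_op :: "'v::ab_group_add cnormed \<Rightarrow> complex \<Rightarrow> ('v \<Rightarrow> 'v) \<Rightarrow> 'v \<Rightarrow> 'v" where
  "shift_op X c T = (\<lambda>x. smult X c x - T x)"

definition boundedly_invertible :: "'v::ab_group_add cnormed \<Rightarrow> ('v \<Rightarrow> 'v) \<Rightarrow> bool" where
  "boundedly_invertible X T \<longleftrightarrow>
     (\<exists>S. bounded_operator X S \<and> (\<forall>x\<in>vecs X. S (T x) = x \<and> T (S x) = x))"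

definition op_spectrum :: "'v::ab_group_add cnormed \<Rightarrow> ('v \<Rightarrow> 'v) \<Rightarrow> complex set" where
  "op_spectrum X T = {c. \<not> boundedly_invertible X (shift_op X c T)}"

definition op_ker :: "'v::ab_group_add cnormed \<Rightarrow> ('v \<Rightarrow> 'v) \<Rightarrow> 'v set" where
  "op_ker X T = {x \<in> vecs X. T x = 0}"

definition op_im :: "'v::ab_group_add cnormed \<Rightarrow> ('v \<Rightarrow> 'v) \<Rightarrow> 'v set" where
  "op_im X T = T ` vecs X"

definition finite_dim :: "'v::ab_group_add cnormed \<Rightarrow> 'v set \<Rightarrow> bool" where
  "finite_dim X U \<longleftrightarrow> (\<exists>B. finite B \<and> B \<subseteq> U \<and> U = module.span (smult X) B)"

text \<open>The quotient of the space by the subspace \<open>U\<close> is spanned by the classes of finitely many vectors.\<close>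

definition finite_codim :: "'v::ab_group_add cnormed \<Rightarrow> 'v set \<Rightarrow> bool" where
  "finite_codim X U \<longleftrightarrow>
     (\<exists>B. finite B \<and> B \<subseteq> vecs X \<and> (\<forall>x\<in>vecs X. \<exists>b\<in>module.span (smult X) B. x - b \<in> U))"

definition fredholm :: "'v::ab_group_add cnormed \<Rightarrow> ('v \<Rightarrow> 'v) \<Rightarrow> bool" where
  "fredholm X T \<longleftrightarrow> finite_dim X (op_ker X T) \<and> finite_codim X (op_im X T)"

definition ess_spectrum :: "'v::ab_group_add cnormed \<Rightarrow> ('v \<Rightarrow> 'v) \<Rightarrow> complex set" where
  "ess_spectrum X T = {c. \<not> fredholm X (shift_op X c T)}"

definition approx_point_spectrum :: "'v::ab_group_add cnormed \<Rightarrow> ('v \<Rightarrow> 'v) \<Rightarrow> complex set" where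
  "approx_point_spectrum X T =
     {c. \<exists>v::nat \<Rightarrow> 'v. (\<forall>k. v k \<in> vecs X \<and> nrm X (v k) = 1) \<and>
           (\<lambda>k. nrm X (shift_op X c T (v k))) \<longlonglongrightarrow> 0}"

section \<open>Continuous vector-valued functions and matrix multiplication operators\<close>

text \<open>
  A continuous function on \<open>P\<close> is represented by its extension by \<open>0\<close> to the whole plane, so that
  two elements are equal iff they agree on \<open>P\<close>.
\<close>

definition C_space :: "complex set \<Rightarrow> (complex \<Rightarrow> complex^'n) cnormed" where
  "C_space P = \<lparr>
     vecs = {f. continuous_on P f \<and> (\<forall>\<theta>. \<theta> \<notin> P \<longrightarrow> f \<theta> = 0)},
     smult = (\<lambda>c f \<theta>. c *s f \<theta>),
     nrm = (\<lambda>f. SUP \<theta>\<in>P. norm (f \<theta>)) \<rparr>"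

definition mult_op :: "(complex \<Rightarrow> complex^'n^'n) \<Rightarrow> (complex \<Rightarrow> complex^'n) \<Rightarrow> (complex \<Rightarrow> complex^'n)"
  where "mult_op A f = (\<lambda>\<theta>. A \<theta> *v f \<theta>)"

definition matrix_spectrum :: "complex^'n^'n \<Rightarrow> complex set" where
  "matrix_spectrum M = {c. \<not> invertible (mat c - M)}"

definition perfect :: "'a::topological_space set \<Rightarrow> bool" where
  "perfect P \<longleftrightarrow> \<not> (\<exists>x. x isolated_in P)"

section \<open>The operator is a bounded operator on a Banach space\<close>

lemma vector_space_C: "vector_space (smult (C_space P :: (complex \<Rightarrow> complex^'n) cnormed))"
  by unfold_locales (auto simp: C_space_def fun_eq_iff vec_eq_iff algebra_simps)

lemma norm_vector_smult: "norm (c *s (x :: complex^'n)) = cmod c * norm x"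
  by (simp add: norm_vec_def norm_mult L2_set_right_distrib)

lemma bdd_above_C:
  assumes "compact P" "f \<in> vecs (C_space P)"
  shows "bdd_above ((\<lambda>\<theta>. norm (f \<theta>)) ` P)"
  using assms
  by (intro bounded_imp_bdd_above compact_imp_bounded compact_continuous_image continuous_on_norm)
     (auto simp: C_space_def)

lemma norm_le_nrm_C:
  assumes "compact P" "f \<in> vecs (C_space P)" "\<theta> \<in> P"
  shows "norm (f \<theta>) \<le> nrm (C_space P) f"
  using cSUP_upper[OF assms(3) bdd_above_C[OF assms(1,2)]] by (simp add: C_space_def)

lemma nrm_C_le:
  assumes "P \<noteq> {}" "\<And>\<theta>. \<theta> \<in> P \<Longrightarrow> norm (f \<theta>) \<le> K"
  shows "nrm (C_space P) f \<le> K"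
  using assms by (auto simp: C_space_def intro!: cSUP_least)

lemma subspace_C:
  "module.subspace (smult (C_space P)) (vecs (C_space P :: (complex \<Rightarrow> complex^'n) cnormed))"
proof -
  interpret vector_space "smult (C_space P :: (complex \<Rightarrow> complex^'n) cnormed)"
    by (rule vector_space_C)
  have "continuous_on P (\<lambda>\<theta>. c *s f \<theta>)" if "continuous_on P f"
    for c and f :: "complex \<Rightarrow> complex^'n"
    using that unfolding vector_scalar_mult_def by (intro continuous_intros)
  then show ?thesis
    unfolding subspace_def by (auto simp: C_space_def plus_fun_def zero_fun_def continuous_on_add)
qed

lemma complete_C:
  fixes s :: "nat \<Rightarrow> complex \<Rightarrow> complex^'n"
  assumes P: "P \<noteq> {}" "compact P" and s: "range s \<subseteq> vecs (C_space P)"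
    and Cauchy: "\<forall>e>0. \<exists>N. \<forall>m\<ge>N. \<forall>k\<ge>N. nrm (C_space P) (s m - s k) < e"
  shows "\<exists>l\<in>vecs (C_space P). (\<lambda>k. nrm (C_space P) (s k - l)) \<longlonglongrightarrow> 0"
proof -
  interpret vector_space "smult (C_space P :: (complex \<Rightarrow> complex^'n) cnormed)"
    by (rule vector_space_C)
  have diff: "s m - s k \<in> vecs (C_space P)" for m k
    using s by (intro subspace_diff subspace_C) auto
  have "uniformly_Cauchy_on P s"
    unfolding uniformly_Cauchy_on_def
  proof (intro allI impI)
    fix e :: real assume "e > 0"
    then obtain N where N: "\<forall>m\<ge>N. \<forall>k\<ge>N. nrm (C_space P) (s m - s k) < e"
      using Cauchy by blast
    show "\<exists>M. \<forall>x\<in>P. \<forall>m\<ge>M. \<forall>n\<ge>M. dist (s m x) (s n x) < e"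
    proof (intro exI[of _ N] ballI allI impI)
      fix x m n assume "x \<in> P" "N \<le> m" "N \<le> n"
      then have "norm ((s m - s n) x) < e"
        using norm_le_nrm_C[OF P(2) diff \<open>x \<in> P\<close>, of m n] N by (meson le_less_trans)
      then show "dist (s m x) (s n x) < e" by (simp add: dist_norm)
    qed
  qed
  then obtain g where g: "uniform_limit P s g sequentially"
    using uniformly_convergent_eq_Cauchy[of P s]
    by (metis Cauchy_uniformly_convergent uniformly_convergent_on_def)
  have s_cont: "continuous_on P (s k)" for k
    using s by (auto simp: C_space_def)
  have "continuous_on P g"
    by (rule uniform_limit_theorem[OF _ g]) (simp_all add: s_cont)
  define l where "l = (\<lambda>\<theta>. if \<theta> \<in> P then g \<theta> else 0)"
  have "continuous_on P l"
    using \<open>continuous_on P g\<close> by (simp add: l_def cong: continuous_on_cong)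
  then have l: "l \<in> vecs (C_space P)" by (simp add: C_space_def l_def)
  have "(\<lambda>k. nrm (C_space P) (s k - l)) \<longlonglongrightarrow> 0"
  proof (rule LIMSEQ_I)
    fix e :: real assume "e > 0"
    then obtain N where N: "\<And>k x. k \<ge> N \<Longrightarrow> x \<in> P \<Longrightarrow> dist (s k x) (g x) < e / 2"
      using g unfolding uniform_limit_sequentially_iff by (meson half_gt_zero)
    have "norm (nrm (C_space P) (s k - l) - 0) < e" if "k \<ge> N" for k
    proof -
      have mem: "s k - l \<in> vecs (C_space P)"
        using s l by (intro subspace_diff subspace_C) auto
      have "nrm (C_space P) (s k - l) \<le> e / 2"
        using N[OF that] by (intro nrm_C_le P) (auto simp: l_def dist_norm less_imp_le)
      moreover obtain x where "x \<in> P" using P by blast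
      then have "0 \<le> nrm (C_space P) (s k - l)"
        using norm_le_nrm_C[OF P(2) mem] norm_ge_zero order_trans by blast
      ultimately show ?thesis using \<open>e > 0\<close> by simp
    qed
    then show "\<exists>N. \<forall>k\<ge>N. norm (nrm (C_space P) (s k - l) - 0) < e" by blast
  qed
  with l show ?thesis by blast
qed

lemma cbanach_space_C:
  assumes P: "P \<noteq> {}" "compact P"
  shows "cbanach_space (C_space P :: (complex \<Rightarrow> complex^'n) cnormed)"
proof -
  let ?X = "C_space P :: (complex \<Rightarrow> complex^'n) cnormed"
  interpret vector_space "smult ?X" by (rule vector_space_C)
  obtain p where p: "p \<in> P" using P by blast
  have nonneg: "0 \<le> nrm ?X f" if "f \<in> vecs ?X" for f
    using norm_le_nrm_C[OF P(2) that p] norm_ge_zero order_trans by blast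
  have zero: "nrm ?X f = 0 \<longleftrightarrow> f = 0" if f: "f \<in> vecs ?X" for f
  proof
    assume "nrm ?X f = 0"
    then have "f \<theta> = 0" if "\<theta> \<in> P" for \<theta> using norm_le_nrm_C[OF P(2) f that] by simp
    then show "f = 0" using f by (auto simp: C_space_def fun_eq_iff)
  qed (use P in \<open>simp add: C_space_def\<close>)
  have smult_le: "nrm ?X (smult ?X c f) \<le> cmod c * nrm ?X f" if "f \<in> vecs ?X" for c f
  proof (intro nrm_C_le P)
    fix \<theta> assume "\<theta> \<in> P"
    show "norm (smult ?X c f \<theta>) \<le> cmod c * nrm ?X f"
      using mult_left_mono[OF norm_le_nrm_C[OF P(2) that \<open>\<theta> \<in> P\<close>] norm_ge_zero[of c]]
      by (simp add: C_space_def norm_vector_smult)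
  qed
  have smult: "nrm ?X (smult ?X c f) = cmod c * nrm ?X f" if f: "f \<in> vecs ?X" for c f
  proof (cases "c = 0")
    case True
    then show ?thesis using zero[OF subspace_0[OF subspace_C]] by simp
  next
    case False
    have "nrm ?X f \<le> cmod (inverse c) * nrm ?X (smult ?X c f)"
      using smult_le[OF subspace_scale[OF subspace_C f], of "inverse c" c] False by simp
    then have "cmod c * nrm ?X f \<le> nrm ?X (smult ?X c f)"
      using False by (simp add: norm_inverse norm_divide field_simps)
    with smult_le[OF f] show ?thesis by (simp add: antisym)
  qed
  have tri: "nrm ?X (f + g) \<le> nrm ?X f + nrm ?X g" if "f \<in> vecs ?X" "g \<in> vecs ?X" for f g
    using that
    by (intro nrm_C_le P) (auto intro!: norm_triangle_mono norm_le_nrm_C P)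
  show ?thesis
    unfolding cbanach_space_def
    by (intro conjI ballI allI impI; (elim conjE)?)
       (simp_all only: vector_space_C subspace_C nonneg zero smult tri complete_C[OF P])
qed

lemma bounded_operator_mult_op:
  fixes A :: "complex \<Rightarrow> complex^'n^'n"
  assumes P: "P \<noteq> {}" "compact P" and A: "continuous_on P A"
  shows "bounded_operator (C_space P) (mult_op A)"
proof -
  have cont: "continuous_on P (\<lambda>\<theta>. A \<theta> *v f \<theta>)" if "continuous_on P f" for f
    using that A unfolding matrix_vector_mult_def by (intro continuous_intros)
  have "compact (A ` P)" using P A by (simp add: compact_continuous_image)
  then obtain b where b: "\<And>\<theta>. \<theta> \<in> P \<Longrightarrow> norm (A \<theta>) \<le> b"
    by (meson bounded_iff compact_imp_bounded imageI)
  have bound: "norm (A \<theta> *v x) \<le> real CARD('n) * b * norm x" if "\<theta> \<in> P" for \<theta> x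
  proof -
    have "norm ((A \<theta> *v x) $ i) \<le> b * norm x" for i
    proof -
      have "norm ((A \<theta> *v x) $ i) \<le> (\<Sum>j\<in>UNIV. norm (A \<theta> $ i $ j) * norm (x $ j))"
        unfolding matrix_vector_mult_def by (simp add: norm_mult sum_norm_le)
      also have "\<dots> \<le> L2_set (\<lambda>j. norm (A \<theta> $ i $ j)) UNIV * L2_set (\<lambda>j. norm (x $ j)) UNIV"
        using L2_set_mult_ineq[of "\<lambda>j. norm (A \<theta> $ i $ j)" "\<lambda>j. norm (x $ j)" UNIV] by simp
      also have "\<dots> = norm (A \<theta> $ i) * norm x" by (simp add: norm_vec_def)
      also have "\<dots> \<le> b * norm x"
        using Finite_Cartesian_Product.norm_nth_le[of "A \<theta>" i] b[OF that]
        by (intro mult_right_mono) auto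
      finally show ?thesis .
    qed
    then have "(\<Sum>i\<in>UNIV. norm ((A \<theta> *v x) $ i)) \<le> (\<Sum>i\<in>(UNIV::'n set). b * norm x)"
      by (rule sum_mono)
    moreover have "norm (A \<theta> *v x) \<le> (\<Sum>i\<in>UNIV. norm ((A \<theta> *v x) $ i))"
      unfolding norm_vec_def by (rule L2_set_le_sum) simp
    ultimately show ?thesis by simp
  qed
  have b0: "0 \<le> b" using P b norm_ge_zero order_trans by blast
  have "nrm (C_space P) (mult_op A f) \<le> (real CARD('n) * b) * nrm (C_space P) f"
    if f: "f \<in> vecs (C_space P)" for f
  proof (intro nrm_C_le P)
    fix \<theta> assume t: "\<theta> \<in> P"
    have "norm (A \<theta> *v f \<theta>) \<le> real CARD('n) * b * norm (f \<theta>)" by (rule bound[OF t])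
    also have "\<dots> \<le> real CARD('n) * b * nrm (C_space P) f"
      using norm_le_nrm_C[OF P(2) f t] b0 by (intro mult_left_mono) auto
    finally show "norm (mult_op A f \<theta>) \<le> real CARD('n) * b * nrm (C_space P) f"
      by (simp add: mult_op_def)
  qed
  moreover have "mult_op A ` vecs (C_space P) \<subseteq> vecs (C_space P)"
    using cont by (auto simp: C_space_def mult_op_def)
  ultimately show ?thesis
    unfolding bounded_operator_def
    by (auto simp: C_space_def mult_op_def fun_eq_iff matrix_vector_right_distrib
        vector_scalar_commute)
qed

end

theory Submission
  imports Defs
begin

text \<open>
  Every resolvent question about \<open>mult_op A\<close> at \<open>c\<close> is a question about the multiplication operator
  with the symbol \<open>M \<theta> = mat c - A \<theta>\<close>. If all \<open>M \<theta>\<close> are invertible, Cramer's rule makes the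
  pointwise inverse continuous, and multiplication by it is a bounded inverse. If \<open>M \<theta>\<close> is singular at
  some point \<open>\<theta>\<close> of \<open>P\<close>, then the operator cannot hit a constant function whose value lies
  outside the range of \<open>M \<theta>\<close>. This gives the spectrum.

  A bounded inverse rules out approximate null vectors and yields trivial kernel and cokernel, so the
  approximate point spectrum and the essential spectrum lie in the spectrum. For the converse, let
  \<open>M \<theta>\<close> be singular.

  A unit vector in the kernel of \<open>M \<theta>\<close>, multiplied by bump functions that shrink to \<open>\<theta>\<close>, is a sequence
  of approximate null vectors (lemma \<open>mult_op_approximate_null_vectors\<close>).

  The failure of the Fredholm property uses that \<open>\<theta>\<close> is a limit point of \<open>P\<close>, and it is due to the image
  alone (lemma \<open>mult_op_image_infinite_codim\<close>). Take a row vector \<open>w \<noteq> 0\<close> with \<open>w v* M \<theta> = 0\<close>. The bilinear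
  pairing of \<open>w\<close> with any function \<open>mult_op M f\<close> in the image is \<open>w v* M \<eta>\<close> paired with \<open>f \<eta>\<close>, hence of
  order \<open>\<epsilon> \<eta>\<close>, the size of \<open>w v* M \<eta>\<close>, which tends to \<open>0\<close> at \<open>\<theta>\<close>. For each \<open>N\<close> choose a continuous
  \<open>t\<close>, vanishing only at \<open>\<theta>\<close>, with \<open>\<epsilon> = O(t ^ Suc N)\<close>. A polynomial in \<open>t\<close> of degree at most \<open>N\<close>
  that is \<open>O(t ^ Suc N)\<close> near \<open>\<theta>\<close> is zero
  (lemma \<open>polynomial_small_along_null_net\<close>). With a vector \<open>u\<close> whose product with \<open>w\<close> is \<open>1\<close>, the
  functions \<open>t ^ k *s u\<close> for \<open>k \<le> N\<close> are therefore linearly independent modulo the image, so the codimension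
  exceeds every \<open>N\<close>.
\<close>

section \<open>Matrices and their inverses\<close>

lemma singular_matrix_left_null_vector:
  fixes M :: "'a::field^'n^'n"
  assumes "\<not> invertible M"
  obtains w where "w \<noteq> 0" "w v* M = 0"
proof -
  have "\<not> invertible (transpose M)"
    using assms invertible_det_nz det_transpose by metis
  then obtain w where "w \<noteq> 0" "transpose M *v w = 0"
    by (auto simp: invertible_left_inverse matrix_left_invertible_ker)
  then show ?thesis using that by simp
qed

text \<open>
  The solution of \<open>M *v x = axis m 1\<close> by Cramer's rule is column \<open>m\<close>. Unlike \<open>matrix_inv\<close>, which
  chooses an inverse, this formula shows how the entries depend on \<open>M\<close>.
\<close>

definition cramer_inverse :: "complex^'n^'n \<Rightarrow> complex^'n^'n" where
  "cramer_inverse M =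
     (\<chi> k m. det (\<chi> i j. if j = k then (if i = m then 1 else 0) else M $ i $ j) / det M)"

lemma cramer_inverse_is_inverse:
  assumes "invertible M"
  shows "M ** cramer_inverse M = mat 1" "cramer_inverse M ** M = mat 1"
proof -
  have d: "det M \<noteq> 0" using assms by (simp add: invertible_det_nz)
  have "column m (M ** cramer_inverse M) = axis m 1" for m
  proof -
    have "M *v (column m (cramer_inverse M)) = axis m 1"
      unfolding cramer[OF d]
      by (simp add: vec_eq_iff column_def cramer_inverse_def axis_def cong: if_cong)
    then show ?thesis
      by (simp add: column_def matrix_matrix_mult_def matrix_vector_mult_def)
  qed
  then show "M ** cramer_inverse M = mat 1"
    by (simp add: vec_eq_iff column_def axis_def mat_def)
  then show "cramer_inverse M ** M = mat 1"
    by (simp add: matrix_left_right_inverse)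
qed

lemma continuous_on_det:
  fixes M :: "'a::topological_space \<Rightarrow> complex^'n^'n"
  assumes "\<And>i j. continuous_on S (\<lambda>x. M x $ i $ j)"
  shows "continuous_on S (\<lambda>x. det (M x))"
  unfolding det_def
  by (intro continuous_on_sum continuous_on_mult continuous_on_prod continuous_on_const assms)

lemma continuous_on_cramer_inverse:
  fixes M :: "'a::topological_space \<Rightarrow> complex^'n^'n"
  assumes M: "continuous_on S M" and inv: "\<And>x. x \<in> S \<Longrightarrow> invertible (M x)"
  shows "continuous_on S (\<lambda>x. cramer_inverse (M x))"
proof -
  have entry: "continuous_on S (\<lambda>x. M x $ i $ j)" for i j
    by (intro continuous_intros M)
  have "continuous_on S (\<lambda>x. (if j = k then (if i = m then 1 else 0) else M x $ i $ j) :: complex)"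
    for i j k m by (cases "j = k") (simp_all add: entry)
  then show ?thesis
    unfolding cramer_inverse_def using inv
    by (intro continuous_intros continuous_on_det entry) (simp_all add: invertible_det_nz entry)
qed

text \<open>
  Read with \<open>w\<close> close to a left null vector of \<open>M\<close>: the right-hand side then shows that \<open>w\<close> nearly
  annihilates the range of \<open>M\<close>, at a rate given by the entries of \<open>w v* M\<close>.
\<close>

lemma vector_matrix_pairing:
  fixes w :: "'a::comm_semiring_1^'m"
  shows "(\<Sum>i\<in>UNIV. w $ i * (M *v x) $ i) = (\<Sum>j\<in>UNIV. (w v* M) $ j * x $ j)"
proof -
  have "(\<Sum>i\<in>UNIV. w $ i * (M *v x) $ i) = (\<Sum>i\<in>UNIV. \<Sum>j\<in>UNIV. w $ i * (M $ i $ j * x $ j))"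
    by (simp add: matrix_vector_mult_def sum_distrib_left)
  also have "\<dots> = (\<Sum>j\<in>UNIV. \<Sum>i\<in>UNIV. w $ i * (M $ i $ j * x $ j))"
    by (rule sum.swap)
  also have "\<dots> = (\<Sum>j\<in>UNIV. (w v* M) $ j * x $ j)"
    by (simp add: vector_matrix_mult_def sum_distrib_right mult.assoc mult.left_commute)
  finally show ?thesis .
qed

section \<open>Consequences of a bounded inverse\<close>

lemma boundedly_invertible_imp_fredholm:
  assumes X: "cbanach_space X" and T: "bounded_operator X T" and inv: "boundedly_invertible X T"
  shows "fredholm X T"
proof -
  interpret vector_space "smult X" using X by (simp add: cbanach_space_def)
  have sub: "subspace (vecs X)" using X by (simp add: cbanach_space_def)
  obtain S where S: "bounded_operator X S" "\<And>x. x \<in> vecs X \<Longrightarrow> S (T x) = x \<and> T (S x) = x"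
    using inv by (auto simp: boundedly_invertible_def)
  have z: "0 \<in> vecs X" using sub by (rule subspace_0)
  then have T0: "T 0 = 0"
    using T unfolding bounded_operator_def by (metis scale_zero_left)
  have "op_ker X T = {0}"
    unfolding op_ker_def using z T0 S(2) by (metis (mono_tags, lifting) Collect_cong singleton_conv)
  then have "finite_dim X (op_ker X T)"
    unfolding finite_dim_def by (intro exI[of _ "{}"]) simp
  moreover have "op_im X T = vecs X"
    using T S unfolding op_im_def bounded_operator_def by (metis image_subset_iff subsetI subset_antisym image_eqI)
  then have "finite_codim X (op_im X T)"
    unfolding finite_codim_def by (intro exI[of _ "{}"]) simp
  ultimately show ?thesis by (simp add: fredholm_def)
qed

text \<open>
  An inverse bounded by \<open>K\<close> forces \<open>1 \<le> K * nrm X (T x)\<close> for every unit vector \<open>x\<close>.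
\<close>

lemma boundedly_invertible_no_approximate_null_vectors:
  assumes T: "bounded_operator X T" and inv: "boundedly_invertible X T"
    and v: "\<And>k::nat. v k \<in> vecs X \<and> nrm X (v k) = 1"
  shows "\<not> (\<lambda>k. nrm X (T (v k))) \<longlonglongrightarrow> 0"
proof
  assume lim: "(\<lambda>k. nrm X (T (v k))) \<longlonglongrightarrow> 0"
  obtain S where S: "bounded_operator X S" "\<And>x. x \<in> vecs X \<Longrightarrow> S (T x) = x"
    using inv by (auto simp: boundedly_invertible_def)
  then obtain K where K: "\<And>x. x \<in> vecs X \<Longrightarrow> nrm X (S x) \<le> K * nrm X x"
    unfolding bounded_operator_def by blast
  have "T (v k) \<in> vecs X" for k using T v by (auto simp: bounded_operator_def)
  then have "1 \<le> K * nrm X (T (v k))" for k using K[of "T (v k)"] S(2)[of "v k"] v[of k] by simp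
  moreover have "(\<lambda>k. K * nrm X (T (v k))) \<longlonglongrightarrow> K * 0" by (intro tendsto_intros lim)
  ultimately have "(1::real) \<le> K * 0" by (intro LIMSEQ_le_const) auto
  then show False by simp
qed

section \<open>Linear relations and polynomials\<close>

text \<open>
  Indexing by natural numbers, instead of taking a linearly dependent set, allows \<open>b\<close> to repeat
  a vector; a repetition is itself a nontrivial relation.
\<close>

lemma (in vector_space) more_vectors_than_generators_relation:
  fixes b :: "nat \<Rightarrow> 'b"
  assumes B: "finite B" and b: "\<And>k. k \<le> card B \<Longrightarrow> b k \<in> span B"
  shows "\<exists>a. (\<exists>k\<le>card B. a k \<noteq> 0) \<and> (\<Sum>k\<le>card B. scale (a k) (b k)) = 0"
proof (cases "inj_on b {..card B}")
  case True
  let ?S = "b ` {..card B}"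
  have "card ?S = Suc (card B)" using True by (simp add: card_image)
  then have "dependent ?S" using independent_span_bound[OF B, of ?S] b by fastforce
  then obtain u where "\<exists>v\<in>?S. u v \<noteq> 0" "(\<Sum>v\<in>?S. scale (u v) v) = 0"
    using dependent_finite[of ?S] by auto
  then show ?thesis using True
    by (intro exI[of _ "u \<circ> b"]) (auto simp: sum.reindex)
next
  case False
  then obtain i j where ij: "i \<le> card B" "j \<le> card B" "i \<noteq> j" "b i = b j"
    by (auto simp: inj_on_def)
  \<comment> \<open>The difference of two indicators encodes the relation \<open>b i - b j = 0\<close>.\<close>
  define a :: "nat \<Rightarrow> 'a" where "a k = (if k = i then 1 else 0) - (if k = j then 1 else 0)" for k
  have "(\<Sum>k\<le>card B. scale (a k) (b k))
      = (\<Sum>k\<le>card B. if k = i then b k else 0) - (\<Sum>k\<le>card B. if k = j then b k else 0)"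
    unfolding sum_subtractf[symmetric] by (intro sum.cong) (auto simp: a_def)
  also have "\<dots> = 0" using ij by (simp add: sum.delta)
  finally show ?thesis using ij by (intro exI[of _ a]) (auto simp: a_def intro!: exI[of _ i])
qed

text \<open>
  The coefficients vanish one after the other: once those below \<open>k\<close> are known to be zero, dividing by
  \<open>t ^ k\<close> leaves a function that tends to \<open>a k\<close> but is still bounded by a positive power of \<open>t\<close>.
\<close>

lemma polynomial_small_along_null_net:
  fixes t :: "'a \<Rightarrow> real" and a :: "nat \<Rightarrow> complex"
  assumes F: "F \<noteq> bot" and t0: "(t \<longlongrightarrow> 0) F" and pos: "\<forall>\<^sub>F x in F. 0 < t x"
    and small: "\<forall>\<^sub>F x in F. cmod (\<Sum>k\<le>N. a k * of_real (t x) ^ k) \<le> C * t x ^ Suc N"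
    and "k \<le> N"
  shows "a k = 0"
  using \<open>k \<le> N\<close>
proof (induction k rule: less_induct)
  case (less k)
  define g where "g x = (\<Sum>j\<in>{k..N}. a j * of_real (t x) ^ (j - k))" for x
  have "(g \<longlongrightarrow> (\<Sum>j\<in>{k..N}. a j * of_real 0 ^ (j - k))) F"
    unfolding g_def by (intro tendsto_intros t0)
  also have "(\<Sum>j\<in>{k..N}. a j * of_real 0 ^ (j - k)) = (\<Sum>j\<in>{k..N}. if j = k then a j else 0)"
    by (intro sum.cong) (auto simp: power_0_left)
  also have "\<dots> = a k" using less.prems by (simp add: sum.delta)
  finally have lim: "(g \<longlongrightarrow> a k) F" .
  have split: "(\<Sum>j\<le>N. a j * of_real (t x) ^ j) = of_real (t x) ^ k * g x" for x
  proof -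
    have "(\<Sum>j\<le>N. a j * of_real (t x) ^ j) = (\<Sum>j\<in>{k..N}. a j * of_real (t x) ^ j)"
      using less by (intro sum.mono_neutral_right) auto
    also have "\<dots> = of_real (t x) ^ k * g x"
      unfolding g_def sum_distrib_left
      by (intro sum.cong) (auto simp: mult_ac simp flip: power_add)
    finally show ?thesis .
  qed
  have "\<forall>\<^sub>F x in F. cmod (g x) \<le> C * t x ^ (Suc N - k)"
    using pos small
  proof eventually_elim
    case (elim x)
    have "t x ^ Suc N = t x ^ k * t x ^ (Suc N - k)"
      using less.prems by (simp flip: power_add)
    then have "t x ^ k * cmod (g x) \<le> t x ^ k * (C * t x ^ (Suc N - k))"
      using elim unfolding split by (simp add: norm_mult norm_power mult_ac)
    then show ?case using elim(1) by simp
  qed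
  moreover have "((\<lambda>x. C * t x ^ (Suc N - k)) \<longlongrightarrow> C * 0 ^ (Suc N - k)) F"
    by (intro tendsto_intros t0)
  then have "((\<lambda>x. C * t x ^ (Suc N - k)) \<longlongrightarrow> 0) F" using less.prems by (simp add: Suc_diff_le)
  ultimately have "(g \<longlongrightarrow> 0) F" by (rule Lim_null_comparison)
  then show ?case by (rule tendsto_unique[OF F lim])
qed

section \<open>Multiplication operators\<close>

text \<open>
  Shifts of multiplication operators are again multiplication operators, so everything below can be
  stated for a general symbol \<open>M\<close>.
\<close>

lemma shift_mult_op:
  fixes A :: "complex \<Rightarrow> complex^'n^'n"
  shows "shift_op (C_space P) c (mult_op A) = mult_op (\<lambda>\<theta>. mat c - A \<theta>)"
proof -
  have "mat c *v x = c *s x" for x :: "complex^'n"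
    by (simp add: vec_eq_iff matrix_vector_mult_def mat_def if_distrib if_distribR cong: if_cong)
  then show ?thesis
    by (simp add: shift_op_def mult_op_def C_space_def fun_eq_iff matrix_vector_mult_diff_rdistrib)
qed

lemma mult_op_boundedly_invertible:
  fixes M :: "complex \<Rightarrow> complex^'n^'n"
  assumes P: "P \<noteq> {}" "compact P" and M: "continuous_on P M"
    and inv: "\<And>\<theta>. \<theta> \<in> P \<Longrightarrow> invertible (M \<theta>)"
  shows "boundedly_invertible (C_space P) (mult_op M)"
  unfolding boundedly_invertible_def
proof (intro exI conjI ballI)
  let ?S = "mult_op (\<lambda>\<theta>. cramer_inverse (M \<theta>))"
  show "bounded_operator (C_space P) ?S"
    by (intro bounded_operator_mult_op P continuous_on_cramer_inverse M inv)
  fix f :: "complex \<Rightarrow> complex^'n"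
  assume f: "f \<in> vecs (C_space P)"
  show "?S (mult_op M f) = f" "mult_op M (?S f) = f"
  proof -
    have "?S (mult_op M f) \<theta> = f \<theta> \<and> mult_op M (?S f) \<theta> = f \<theta>" for \<theta>
      using f by (cases "\<theta> \<in> P")
        (auto simp: mult_op_def C_space_def matrix_vector_mul_assoc cramer_inverse_is_inverse inv)
    then show "?S (mult_op M f) = f" "mult_op M (?S f) = f" by auto
  qed
qed

text \<open>
  A preimage of the function that is constantly \<open>y\<close> on \<open>P\<close> contains, at \<open>\<theta>\<close>, a solution of
  \<open>M \<theta> *v z = y\<close>. So surjectivity of the operator passes to each matrix.
\<close>

lemma mult_op_invertible_imp_pointwise:
  fixes M :: "complex \<Rightarrow> complex^'n^'n"
  assumes inv: "boundedly_invertible (C_space P) (mult_op M)" and \<theta>: "\<theta> \<in> P"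
  shows "invertible (M \<theta>)"
proof -
  obtain S where S: "\<And>f. f \<in> vecs (C_space P) \<Longrightarrow> mult_op M (S f) = f"
    using inv by (auto simp: boundedly_invertible_def)
  have "y \<in> range ((*v) (M \<theta>))" for y
  proof -
    let ?f = "\<lambda>\<eta>. if \<eta> \<in> P then y else 0"
    have "?f \<in> vecs (C_space P)"
      by (auto simp: C_space_def cong: continuous_on_cong)
    then have "mult_op M (S ?f) \<theta> = y" using S \<theta> by simp
    then have "y = M \<theta> *v S ?f \<theta>" by (simp add: mult_op_def)
    then show ?thesis by (rule range_eqI)
  qed
  then show ?thesis
    by (auto simp: invertible_right_inverse matrix_right_invertible_surjective)
qed

text \<open>
  A tent function of height \<open>1\<close> and radius \<open>1 / k\<close> around \<open>\<theta>\<close>, times a unit null vector \<open>x\<close> of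
  \<open>M \<theta>\<close>, keeps norm \<open>1\<close>, while its image only sees the values of \<open>M \<eta> *v x\<close> at points \<open>\<eta>\<close> near \<open>\<theta>\<close>,
  which are small by continuity.
\<close>

lemma mult_op_approximate_null_vectors:
  fixes M :: "complex \<Rightarrow> complex^'n^'n"
  assumes P: "compact P" and M: "continuous_on P M"
    and \<theta>: "\<theta> \<in> P" and sing: "\<not> invertible (M \<theta>)"
  shows "\<exists>v::nat \<Rightarrow> _. (\<forall>k. v k \<in> vecs (C_space P) \<and> nrm (C_space P) (v k) = 1) \<and>
           (\<lambda>k. nrm (C_space P) (mult_op M (v k))) \<longlonglongrightarrow> 0"
proof -
  have Pne: "P \<noteq> {}" using \<theta> by auto
  obtain y where y: "y \<noteq> 0" "M \<theta> *v y = 0"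
    using sing by (auto simp: invertible_left_inverse matrix_left_invertible_ker)
  define x where "x = complex_of_real (inverse (norm y)) *s y"
  have x: "norm x = 1" "M \<theta> *v x = 0"
    using y by (simp_all add: x_def norm_vector_smult vector_scalar_commute norm_inverse)
  define \<phi> :: "nat \<Rightarrow> complex \<Rightarrow> real" where "\<phi> k \<eta> = max 0 (1 - real k * dist \<eta> \<theta>)" for k \<eta>
  have \<phi>: "0 \<le> \<phi> k \<eta>" "\<phi> k \<eta> \<le> 1" "\<phi> k \<theta> = 1" for k \<eta> by (simp_all add: \<phi>_def)
  define v where "v k = (\<lambda>\<eta>. if \<eta> \<in> P then complex_of_real (\<phi> k \<eta>) *s x else 0)" for k
  have "continuous_on P (\<lambda>\<eta>. complex_of_real (\<phi> k \<eta>) *s x)" for k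
    unfolding vector_scalar_mult_def \<phi>_def by (intro continuous_intros)
  then have v: "v k \<in> vecs (C_space P)" for k
    by (simp add: C_space_def v_def cong: continuous_on_cong)
  have nv: "nrm (C_space P) (v k) = 1" for k
  proof (rule antisym)
    show "nrm (C_space P) (v k) \<le> 1"
      using \<phi> x by (intro nrm_C_le Pne) (simp add: v_def norm_vector_smult)
    show "1 \<le> nrm (C_space P) (v k)"
      using norm_le_nrm_C[OF P v \<theta>, of k] \<theta> x \<phi> by (simp add: v_def norm_vector_smult)
  qed
  have cont: "continuous_on P (\<lambda>\<eta>. M \<eta> *v x)"
    unfolding matrix_vector_mult_def by (intro continuous_intros M)
  have Mv: "norm (mult_op M (v k) \<eta>) = \<phi> k \<eta> * norm (M \<eta> *v x)" if "\<eta> \<in> P" for k \<eta>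
    using that \<phi> by (simp add: mult_op_def v_def vector_scalar_commute norm_vector_smult)
  have "(\<lambda>k. nrm (C_space P) (mult_op M (v k))) \<longlonglongrightarrow> 0"
  proof (rule LIMSEQ_I)
    fix e :: real assume e: "0 < e"
    obtain d where d: "d > 0" "\<And>\<eta>. \<eta> \<in> P \<Longrightarrow> dist \<eta> \<theta> < d \<Longrightarrow> norm (M \<eta> *v x) < e / 2"
      using cont \<theta> e x(2) unfolding continuous_on_iff by (metis dist_0_norm dist_commute half_gt_zero)
    obtain N :: nat where N: "1 / d < real N" using reals_Archimedean2 by blast
    have "norm (nrm (C_space P) (mult_op M (v k)) - 0) < e" if k: "N \<le> k" for k
    proof -
      have "norm (mult_op M (v k) \<eta>) \<le> e / 2" if \<eta>: "\<eta> \<in> P" for \<eta>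
      proof (cases "dist \<eta> \<theta> < d")
        case True
        have "\<phi> k \<eta> * norm (M \<eta> *v x) \<le> 1 * (e / 2)"
          using d(2)[OF \<eta> True] \<phi> by (intro mult_mono) auto
        then show ?thesis using Mv[OF \<eta>] by simp
      next
        case False
        have "1 < real N * d" using N d(1) by (simp add: divide_less_eq)
        also have "\<dots> \<le> real k * d" using k d(1) by simp
        also have "\<dots> \<le> real k * dist \<eta> \<theta>" using False by (intro mult_left_mono) auto
        finally have "\<phi> k \<eta> = 0" by (simp add: \<phi>_def)
        then show ?thesis using Mv[OF \<eta>] e by simp
      qed
      then have "nrm (C_space P) (mult_op M (v k)) \<le> e / 2" by (intro nrm_C_le Pne)
      moreover have "mult_op M (v k) \<in> vecs (C_space P)"
        using bounded_operator_mult_op[OF Pne P M] v unfolding bounded_operator_def by blast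
      then have "0 \<le> nrm (C_space P) (mult_op M (v k))"
        using norm_le_nrm_C[OF P _ \<theta>] norm_ge_zero order_trans by blast
      ultimately show ?thesis using e by simp
    qed
    then show "\<exists>N. \<forall>k\<ge>N. norm (nrm (C_space P) (mult_op M (v k)) - 0) < e" by blast
  qed
  with v nv show ?thesis by blast
qed

text \<open>
  If \<open>N\<close> vectors spanned the quotient by the image, some nontrivial combination of the \<open>Suc N\<close> functions
  \<open>h k = t ^ k *s u\<close> with \<open>k \<le> N\<close> would be in the image. Its pairing with the left null vector \<open>w\<close>
  is a polynomial in \<open>t\<close> of degree at most \<open>N\<close>, but membership in the image makes it \<open>O(t ^ Suc N)\<close>. That
  contradicts lemma \<open>polynomial_small_along_null_net\<close>, because a limit point provides arguments with
  arbitrarily small positive values of \<open>t\<close>.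
\<close>

lemma mult_op_image_infinite_codim:
  fixes M :: "complex \<Rightarrow> complex^'n^'n"
  assumes P: "compact P" and M: "continuous_on P M"
    and \<theta>: "\<theta> \<in> P" "\<theta> islimpt P" and sing: "\<not> invertible (M \<theta>)"
  shows "\<not> finite_codim (C_space P) (op_im (C_space P) (mult_op M))"
proof
  let ?X = "C_space P :: (complex \<Rightarrow> complex^'n) cnormed"
  interpret vector_space "smult ?X" by (rule vector_space_C)
  assume "finite_codim ?X (op_im ?X (mult_op M))"
  then obtain B where B: "finite B"
      "\<And>h. h \<in> vecs ?X \<Longrightarrow> \<exists>b\<in>span B. h - b \<in> op_im ?X (mult_op M)"
    unfolding finite_codim_def by blast
  define N where "N = card B"
  obtain w where w: "w \<noteq> 0" "w v* M \<theta> = 0" using singular_matrix_left_null_vector[OF sing] .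
  then obtain m where m: "w $ m \<noteq> 0" by (auto simp: vec_eq_iff)
  define u :: "complex^'n" where "u = axis m (1 / w $ m)"
  have wu: "(\<Sum>i\<in>UNIV. w $ i * u $ i) = 1"
  proof -
    have "(\<Sum>i\<in>UNIV. w $ i * u $ i) = (\<Sum>i\<in>UNIV. if i = m then w $ i * (1 / w $ m) else 0)"
      by (intro sum.cong) (auto simp: u_def axis_def)
    then show ?thesis using m by simp
  qed
  define \<epsilon> where "\<epsilon> \<eta> = (\<Sum>j\<in>UNIV. cmod ((w v* M \<eta>) $ j))" for \<eta>
  have \<epsilon>_cont: "continuous_on P \<epsilon>"
    unfolding \<epsilon>_def vector_matrix_mult_def by (simp, intro continuous_intros M)
  have \<epsilon>: "0 \<le> \<epsilon> \<eta>" "\<epsilon> \<theta> = 0" for \<eta> using w by (simp_all add: \<epsilon>_def sum_nonneg)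
  \<comment> \<open>The root makes \<open>t ^ Suc N\<close> dominate \<open>\<epsilon>\<close>, which controls the functions in the image; the distance keeps \<open>t\<close>
    positive away from \<open>\<theta>\<close> even where \<open>\<epsilon>\<close> vanishes.\<close>
  define t where "t \<eta> = root (Suc N) (\<epsilon> \<eta> + dist \<eta> \<theta>)" for \<eta>
  have t_cont: "continuous_on P t" unfolding t_def by (intro continuous_intros \<epsilon>_cont)
  have t_pow: "t \<eta> ^ Suc N = \<epsilon> \<eta> + dist \<eta> \<theta>" for \<eta>
    unfolding t_def using \<epsilon> by (intro real_root_pow_pos2) auto
  have t_pos: "0 < t \<eta>" if "\<eta> \<noteq> \<theta>" for \<eta>
    unfolding t_def using that \<epsilon>(1)[of \<eta>] by (simp add: add_nonneg_pos)
  define h where "h k = (\<lambda>\<eta>. if \<eta> \<in> P then complex_of_real (t \<eta>) ^ k *s u else 0)" for k :: nat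
  have "continuous_on P (\<lambda>\<eta>. complex_of_real (t \<eta>) ^ k *s u)" for k
    unfolding vector_scalar_mult_def by (intro continuous_intros t_cont)
  then have "h k \<in> vecs ?X" for k by (simp add: C_space_def h_def cong: continuous_on_cong)
  then have "\<exists>b f. b \<in> span B \<and> f \<in> vecs ?X \<and> h k - b = mult_op M f" for k
    using B(2)[of "h k"] by (auto simp: op_im_def)
  then obtain b f where b: "\<And>k. b k \<in> span B" and f: "\<And>k. f k \<in> vecs ?X"
      and hb: "\<And>k. h k - b k = mult_op M (f k)" by metis
  obtain a where a: "(\<exists>k\<le>N. a k \<noteq> 0) \<and> (\<Sum>k\<le>N. smult ?X (a k) (b k)) = 0"
    using more_vectors_than_generators_relation[where b = b, OF B(1) b] unfolding N_def by (rule exE)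
  note a = a[THEN conjunct1] a[THEN conjunct2]
  define g where "g = (\<Sum>k\<le>N. smult ?X (a k) (f k))"
  have g: "g \<in> vecs ?X" unfolding g_def by (intro subspace_sum subspace_scale subspace_C f)
  have sum_apply: "(\<Sum>k\<le>N. F k) \<eta> = (\<Sum>k\<le>N. F k \<eta>)" for F :: "nat \<Rightarrow> complex \<Rightarrow> complex^'n" and \<eta>
    by (induction N) simp_all
  have mult_sum: "Q *v (\<Sum>k\<le>N. F k) = (\<Sum>k\<le>N. Q *v F k)"
    for Q :: "complex^'n^'n" and F :: "nat \<Rightarrow> complex^'n"
    by (induction N) (simp_all add: matrix_vector_right_distrib)
  \<comment> \<open>The combination of the \<open>h k\<close> with coefficients \<open>a k\<close> equals \<open>mult_op M g\<close> on \<open>P\<close>, since the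
    generators \<open>b k\<close> cancel; pairing with \<open>w\<close> turns this into a scalar identity.\<close>
  have "(\<Sum>k\<le>N. a k * of_real (t \<eta>) ^ k) = (\<Sum>j\<in>UNIV. (w v* M \<eta>) $ j * g \<eta> $ j)"
    if \<eta>: "\<eta> \<in> P" for \<eta>
  proof -
    have "(\<Sum>k\<le>N. a k *s b k \<eta>) = 0"
      using fun_cong[OF a(2), of \<eta>] by (simp add: sum_apply C_space_def)
    moreover have "h k \<eta> = b k \<eta> + M \<eta> *v f k \<eta>" for k
      using fun_cong[OF hb, of k \<eta>] by (simp add: mult_op_def algebra_simps)
    ultimately have "(\<Sum>k\<le>N. a k *s h k \<eta>) = (\<Sum>k\<le>N. a k *s (M \<eta> *v f k \<eta>))"
      by (simp add: vector_add_ldistrib sum.distrib)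
    also have "\<dots> = M \<eta> *v g \<eta>"
      by (simp add: g_def sum_apply C_space_def mult_sum vector_scalar_commute)
    finally have eq: "(\<Sum>k\<le>N. a k *s h k \<eta>) = M \<eta> *v g \<eta>" .
    have "(\<Sum>k\<le>N. a k *s h k \<eta>) = (\<Sum>k\<le>N. a k * of_real (t \<eta>) ^ k) *s u"
      using \<eta> by (simp add: h_def vec_eq_iff sum_distrib_right mult.assoc)
    then have "(\<Sum>i\<in>UNIV. w $ i * (M \<eta> *v g \<eta>) $ i)
        = (\<Sum>i\<in>UNIV. w $ i * ((\<Sum>k\<le>N. a k * of_real (t \<eta>) ^ k) * u $ i))"
      using eq by simp
    also have "\<dots> = (\<Sum>k\<le>N. a k * of_real (t \<eta>) ^ k) * (\<Sum>i\<in>UNIV. w $ i * u $ i)"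
      by (subst sum_distrib_left) (simp only: mult.left_commute)
    finally show ?thesis using wu vector_matrix_pairing[of w "M \<eta>" "g \<eta>"] by simp
  qed
  moreover have "cmod (\<Sum>j\<in>UNIV. (w v* M \<eta>) $ j * g \<eta> $ j) \<le> nrm ?X g * t \<eta> ^ Suc N"
    if \<eta>: "\<eta> \<in> P" for \<eta>
  proof -
    have ng: "norm (g \<eta>) \<le> nrm ?X g" by (rule norm_le_nrm_C[OF P g \<eta>])
    have "cmod (\<Sum>j\<in>UNIV. (w v* M \<eta>) $ j * g \<eta> $ j)
        \<le> (\<Sum>j\<in>UNIV. cmod ((w v* M \<eta>) $ j) * norm (g \<eta>))"
      by (intro sum_norm_le) (simp add: norm_mult mult_left_mono Finite_Cartesian_Product.norm_nth_le)
    also have "\<dots> = \<epsilon> \<eta> * norm (g \<eta>)" by (simp add: \<epsilon>_def sum_distrib_right)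
    also have "\<dots> \<le> t \<eta> ^ Suc N * nrm ?X g"
      unfolding t_pow using ng \<epsilon>(1) by (intro mult_mono) auto
    finally show ?thesis by (simp add: mult.commute)
  qed
  ultimately have small: "cmod (\<Sum>k\<le>N. a k * of_real (t \<eta>) ^ k) \<le> nrm ?X g * t \<eta> ^ Suc N"
    if "\<eta> \<in> P" for \<eta> using that by metis
  let ?F = "at \<theta> within P"
  have "a k = 0" if "k \<le> N" for k
  proof (rule polynomial_small_along_null_net[where F = ?F, OF _ _ _ _ that])
    show "?F \<noteq> bot" using \<theta>(2) by (simp add: trivial_limit_within)
    have "t \<theta> = 0" by (simp add: t_def \<epsilon>)
    then show "(t \<longlongrightarrow> 0) ?F" using t_cont \<theta>(1) by (metis continuous_on_def)
    show "\<forall>\<^sub>F \<eta> in ?F. 0 < t \<eta>" unfolding eventually_at_filter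
      by (intro always_eventually allI impI t_pos)
    show "\<forall>\<^sub>F \<eta> in ?F. cmod (\<Sum>k\<le>N. a k * of_real (t \<eta>) ^ k) \<le> nrm ?X g * t \<eta> ^ Suc N"
      unfolding eventually_at_filter by (intro always_eventually allI impI small)
  qed
  with a(1) show False by blast
qed

theorem proposition2p2:
  fixes P :: "complex set" and A :: "complex \<Rightarrow> complex^'n^'n"
  assumes "P \<noteq> {}" and "compact P" and "continuous_on P A"
  shows "op_spectrum (C_space P) (mult_op A) = (\<Union>\<theta>\<in>P. matrix_spectrum (A \<theta>)) \<and>
    (perfect P \<longrightarrow>
       approx_point_spectrum (C_space P) (mult_op A) = ess_spectrum (C_space P) (mult_op A) \<and>
       ess_spectrum (C_space P) (mult_op A) = op_spectrum (C_space P) (mult_op A) \<and>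
       op_spectrum (C_space P) (mult_op A) = (\<Union>\<theta>\<in>P. matrix_spectrum (A \<theta>)))"
proof -
  let ?X = "C_space P :: (complex \<Rightarrow> complex^'n) cnormed"
  note P = assms(1,2)
  have M: "continuous_on P (\<lambda>\<theta>. mat c - A \<theta>)" for c
    by (intro continuous_intros assms)
  note op = bounded_operator_mult_op[OF P M]
  let ?U = "\<Union>\<theta>\<in>P. matrix_spectrum (A \<theta>)"
  have spectrum: "op_spectrum ?X (mult_op A) = ?U"
    unfolding op_spectrum_def matrix_spectrum_def shift_mult_op
    using mult_op_boundedly_invertible[OF P M] mult_op_invertible_imp_pointwise by blast
  have approx: "approx_point_spectrum ?X (mult_op A) = op_spectrum ?X (mult_op A)"
  proof (rule equalityI)
    show "approx_point_spectrum ?X (mult_op A) \<subseteq> op_spectrum ?X (mult_op A)"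
      unfolding op_spectrum_def approx_point_spectrum_def shift_mult_op
      using boundedly_invertible_no_approximate_null_vectors[OF op] by blast
    show "op_spectrum ?X (mult_op A) \<subseteq> approx_point_spectrum ?X (mult_op A)"
      unfolding spectrum approx_point_spectrum_def matrix_spectrum_def shift_mult_op
      using mult_op_approximate_null_vectors[OF P(2) M] by blast
  qed
  have ess: "ess_spectrum ?X (mult_op A) = op_spectrum ?X (mult_op A)" if "perfect P"
  proof (rule equalityI)
    show "ess_spectrum ?X (mult_op A) \<subseteq> op_spectrum ?X (mult_op A)"
      unfolding op_spectrum_def ess_spectrum_def shift_mult_op
      using boundedly_invertible_imp_fredholm[OF cbanach_space_C[OF P] op] by blast
    have "\<theta> islimpt P" if "\<theta> \<in> P" for \<theta>
      using \<open>perfect P\<close> that by (auto simp: perfect_def isolated_in_islimpt_iff)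
    then show "op_spectrum ?X (mult_op A) \<subseteq> ess_spectrum ?X (mult_op A)"
      unfolding spectrum ess_spectrum_def matrix_spectrum_def shift_mult_op fredholm_def
      using mult_op_image_infinite_codim[OF P(2) M] by blast
  qed
  show ?thesis using spectrum approx ess by simp
qed

end
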